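(* Let $S$ be a discrete semigroup, $A\subseteq S$ and let $\mathcal{F}$ be a filter on $S$. The following equivalences hold: (1) $A$ is $\mathcal{F}$-syndetic if and only if there exists a hyperfinite $\Gamma\subseteq\mu(\mathcal{F})$ with $\Gamma^{-1}A^{\ast}\in\mathcal{F}^{\ast}$; (2) $A$ is piecewise $\mathcal{F}$-syndetic if and only if there exist $W\in\mathcal{F}^{\ast}$, a hyperfinite $\Gamma\subseteq\mu(\mathcal{F})$ and $\beta\in\mu(\mathcal{F})$ such that $\beta^{\ast}\in\bigcap_{x\in W}x^{-1}\Gamma^{-1}A^{\ast\ast}$, i.e. such that $W\beta^{\ast}\subseteq\Gamma^{-1}A^{\ast\ast}$.
   Context: Combinatorial notions: for $x\in S$, $A,G\subseteq S$ put $x^{-1}A=\{y\in S: xy\in A\}$ and $G^{-1}A=\bigcup_{x\in G}x^{-1}A$. $A\subseteq S$ is $\mathcal{F}$-syndetic if for every $V\in\mathcal{F}$ there is a finite set $G\subseteq V$ such that $G^{-1}A\in\mathcal{F}$. $A$ is piecewise $\mathcal{F}$-syndetic if for every $V\in\mathcal{F}$ there are a finite $F_V\subseteq V$ and $W_V\in\mathcal{F}$ such that the family $\{(x^{-1}F_V^{-1}A)\cap V: V\in\mathcal{F},\ x\in W_V\}$ has the finite intersection property. Nonstandard setting: we work with a nonstandard extension map $\ast$ which can be iterated (so that $\ast$ can also be applied to nonstandard objects, and the transfer principle holds at each step), with $s^{\ast}=s$ for $s\in S$, and which is sufficiently saturated (e.g. $\kappa$-saturated for some $\kappa$ larger than the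 cardinality of the power set of $S$, so that in particular the enlarging property holds for families of at most $2^{|S|}$ sets). $A^{\ast\ast}=(A^{\ast})^{\ast}$, and $S\subseteq S^{\ast}\subseteq S^{\ast\ast}$; for $\beta\in S^{\ast}$, $\beta^{\ast}\in S^{\ast\ast}$ is the image of $\beta$ under $\ast$. The extended semigroup operations are denoted like that of $S$. The set $\mu(\mathcal{F})=\{\alpha\in S^{\ast}: \alpha\in B^{\ast}\text{ for all }B\in\mathcal{F}\}$. A hyperfinite $\Gamma\subseteq S^\ast$ is an element of $(\wp_{fin}(S))^{\ast}$, where $\wp_{fin}(S)$ is the set of finite subsets of $S$. $\Gamma^{-1}A^{\ast}=\{\sigma\in S^{\ast}:\exists\gamma\in\Gamma\ \gamma\sigma\in A^{\ast}\}$, and $\Gamma^{-1}A^{\ast\ast}=\{\sigma\in S^{\ast\ast}:\exists\gamma\in\Gamma\ \gamma\sigma\in A^{\ast\ast}\}$; for $x\in S^{\ast}$ and $B\subseteq S^{\ast\ast}$, $x^{-1}B=\{\sigma\in S^{\ast\ast}: x\sigma\in B\}$, and $W\beta^{\ast}=\{x\beta^{\ast}:x\in W\}$. *)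

theory Defs
  imports Main
begin

section \<open>Syndetic and piecewise syndetic sets relative to a filter\<close>

definition filter_sets :: "'a filter \<Rightarrow> 'a set set" where
  "filter_sets F = {V. eventually (\<lambda>x. x \<in> V) F}"

definition left_quot :: "'a::semigroup_mult \<Rightarrow> 'a set \<Rightarrow> 'a set" where
  "left_quot x A = {y. x * y \<in> A}"

definition left_quot_set :: "'a::semigroup_mult set \<Rightarrow> 'a set \<Rightarrow> 'a set" where
  "left_quot_set G A = (\<Union>x\<in>G. left_quot x A)"

definition fin_inter_prop :: "'b set set \<Rightarrow> bool" where
  "fin_inter_prop \<C> \<longleftrightarrow> (\<forall>\<D>\<subseteq>\<C>. finite \<D> \<longrightarrow> \<Inter>\<D> \<noteq> {})"

definition syndetic :: "'a::semigroup_mult filter \<Rightarrow> 'a set \<Rightarrow> bool" where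
  "syndetic F A \<longleftrightarrow>
     (\<forall>V\<in>filter_sets F. \<exists>G\<subseteq>V. finite G \<and> left_quot_set G A \<in> filter_sets F)"

definition piecewise_syndetic :: "'a::semigroup_mult filter \<Rightarrow> 'a set \<Rightarrow> bool" where
  "piecewise_syndetic F A \<longleftrightarrow>
     (\<exists>K W. (\<forall>V\<in>filter_sets F. finite (K V) \<and> K V \<subseteq> V \<and> W V \<in> filter_sets F) \<and>
        fin_inter_prop {left_quot x (left_quot_set (K V) A) \<inter> V | V x. V \<in> filter_sets F \<and> x \<in> W V})"


section \<open>Nonstandard extensions that can be iterated\<close>

text \<open>
  The universe is a type of objects (atoms and sets) with a membership relation, given by the
  set of elements of each object; the star map sends the universe to itself, so it
  can be applied to nonstandard objects as well. The points of the semigroup, a type,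
  are embedded into the universe.
\<close>

record ('a, 'v) nonstandard_structure =
  elts :: "'v \<Rightarrow> 'v set"
  atoms :: "'v set"
  emb :: "'a \<Rightarrow> 'v"
  star :: "'v \<Rightarrow> 'v"

text \<open>Bounded formulas of the language of set theory; variables are natural numbers, and
  \<open>Ball i j \<phi>\<close> stands for ``for all \<open>v\<^sub>i \<in> v\<^sub>j\<close>, \<open>\<phi>\<close>''.\<close>

datatype bounded_fm =
    Mem nat nat
  | Eq nat nat
  | Neg bounded_fm
  | Conj bounded_fm bounded_fm
  | Ball nat nat bounded_fm

primrec holds :: "('a, 'v) nonstandard_structure \<Rightarrow> (nat \<Rightarrow> 'v) \<Rightarrow> bounded_fm \<Rightarrow> bool" where
  "holds N e (Mem i j) \<longleftrightarrow> e i \<in> elts N (e j)"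
| "holds N e (Eq i j) \<longleftrightarrow> e i = e j"
| "holds N e (Neg \<phi>) \<longleftrightarrow> \<not> holds N e \<phi>"
| "holds N e (Conj \<phi> \<psi>) \<longleftrightarrow> holds N e \<phi> \<and> holds N e \<psi>"
| "holds N e (Ball i j \<phi>) \<longleftrightarrow> (\<forall>x\<in>elts N (e j). holds N (e(i := x)) \<phi>)"

text \<open>The set with the given elements; meaningful only if the universe has such a set.\<close>

definition mk_set :: "('a, 'v) nonstandard_structure \<Rightarrow> 'v set \<Rightarrow> 'v" where
  "mk_set N B = (THE x. x \<notin> atoms N \<and> elts N x = B)"

definition mk_pair :: "('a, 'v) nonstandard_structure \<Rightarrow> 'v \<Rightarrow> 'v \<Rightarrow> 'v" where
  "mk_pair N a b = mk_set N {mk_set N {a}, mk_set N {a, b}}"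

definition has_set :: "('a, 'v) nonstandard_structure \<Rightarrow> 'v set \<Rightarrow> bool" where
  "has_set N B \<longleftrightarrow> (\<exists>x. x \<notin> atoms N \<and> elts N x = B)"

text \<open>
  Every superstructure over a set of atoms containing \<open>S\<close> satisfies the closure conditions on
  the universe below. Power sets are required only for \<open>S\<close> itself: a universe closed under all
  power sets is too large for a type constructible in HOL, and the weaker conditions leave
  room for both.

  Internal objects are the elements of the objects \<open>star y\<close>. The axiom \<open>saturation\<close>
  is \<open>\<kappa>\<close>-saturation for \<open>\<kappa>\<close> the successor of the cardinality of the power set of \<open>S\<close>,
  families of at most \<open>2\<^bsup>|S|\<^esup>\<close> sets being those indexed, possibly with repetitions, by
  \<open>'a set\<close>.
\<close>

locale nonstandard_extension =
  fixes N :: "('a, 'v) nonstandard_structure"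
  assumes atoms_empty: "x \<in> atoms N \<Longrightarrow> elts N x = {}"
    and extensionality: "\<lbrakk>x \<notin> atoms N; y \<notin> atoms N; elts N x = elts N y\<rbrakk> \<Longrightarrow> x = y"
    and subsets: "B \<subseteq> elts N x \<Longrightarrow> has_set N B"
    and pairing: "has_set N {x, y}"
    and union: "has_set N (\<Union>y\<in>elts N x. elts N y)"
    and products: "has_set N {mk_pair N a b | a b. a \<in> elts N x \<and> b \<in> elts N y}"
    and inj_emb: "inj (emb N)"
    and set_S: "has_set N (range (emb N))"
    and power_S: "has_set N {x. x \<notin> atoms N \<and> elts N x \<subseteq> range (emb N)}"
    and star_atoms: "star N x \<in> atoms N \<longleftrightarrow> x \<in> atoms N"
    and star_emb: "star N (emb N s) = emb N s"
    and transfer: "holds N (\<lambda>i. star N (e i)) \<phi> \<longleftrightarrow> holds N e \<phi>"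
    and saturation:
      "\<And>X :: 'a set \<Rightarrow> 'v.
         \<lbrakk>\<And>i. \<exists>y. X i \<in> elts N (star N y); fin_inter_prop (range (\<lambda>i. elts N (X i)))\<rbrakk>
         \<Longrightarrow> (\<Inter>i. elts N (X i)) \<noteq> {}"

text \<open>The objects of the universe that represent subsets of the semigroup, families of such
  subsets, and the graph of the multiplication.\<close>

definition set_obj :: "('a, 'v) nonstandard_structure \<Rightarrow> 'a set \<Rightarrow> 'v" where
  "set_obj N A = mk_set N (emb N ` A)"

definition family_obj :: "('a, 'v) nonstandard_structure \<Rightarrow> 'a set set \<Rightarrow> 'v" where
  "family_obj N \<C> = mk_set N (set_obj N ` \<C>)"

definition mult_obj :: "('a::semigroup_mult, 'v) nonstandard_structure \<Rightarrow> 'v" where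
  "mult_obj N =
     mk_set N {mk_pair N (emb N x) (mk_pair N (emb N y) (emb N (x * y))) | x y. True}"

definition apply_op :: "('a, 'v) nonstandard_structure \<Rightarrow> 'v \<Rightarrow> 'v \<Rightarrow> 'v \<Rightarrow> 'v" where
  "apply_op N m a b = (THE c. mk_pair N a (mk_pair N b c) \<in> elts N m)"

text \<open>The multiplications of \<open>S\<^sup>*\<close> and of \<open>S\<^sup>*\<^sup>*\<close>.\<close>

definition star_mult :: "('a::semigroup_mult, 'v) nonstandard_structure \<Rightarrow> 'v \<Rightarrow> 'v \<Rightarrow> 'v" where
  "star_mult N = apply_op N (star N (mult_obj N))"

definition star2_mult :: "('a::semigroup_mult, 'v) nonstandard_structure \<Rightarrow> 'v \<Rightarrow> 'v \<Rightarrow> 'v" where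
  "star2_mult N = apply_op N (star N (star N (mult_obj N)))"

definition star_set :: "('a, 'v) nonstandard_structure \<Rightarrow> 'a set \<Rightarrow> 'v set" where
  "star_set N A = elts N (star N (set_obj N A))"

definition star2_set :: "('a, 'v) nonstandard_structure \<Rightarrow> 'a set \<Rightarrow> 'v set" where
  "star2_set N A = elts N (star N (star N (set_obj N A)))"

definition star_family :: "('a, 'v) nonstandard_structure \<Rightarrow> 'a set set \<Rightarrow> 'v set set" where
  "star_family N \<C> = elts N ` elts N (star N (family_obj N \<C>))"

definition hyperfinite :: "('a, 'v) nonstandard_structure \<Rightarrow> 'v set \<Rightarrow> bool" where
  "hyperfinite N \<Gamma> \<longleftrightarrow> \<Gamma> \<in> star_family N {G. finite G}"

definition monad :: "('a, 'v) nonstandard_structure \<Rightarrow> 'a filter \<Rightarrow> 'v set" where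
  "monad N F = {\<alpha> \<in> star_set N UNIV. \<forall>B\<in>filter_sets F. \<alpha> \<in> star_set N B}"

definition star_quot :: "('a::semigroup_mult, 'v) nonstandard_structure \<Rightarrow> 'v set \<Rightarrow> 'a set \<Rightarrow> 'v set" where
  "star_quot N \<Gamma> A =
     {\<sigma> \<in> star_set N UNIV. \<exists>\<gamma>\<in>\<Gamma>. star_mult N \<gamma> \<sigma> \<in> star_set N A}"

definition star2_quot :: "('a::semigroup_mult, 'v) nonstandard_structure \<Rightarrow> 'v set \<Rightarrow> 'a set \<Rightarrow> 'v set" where
  "star2_quot N \<Gamma> A =
     {\<sigma> \<in> star2_set N UNIV. \<exists>\<gamma>\<in>\<Gamma>. star2_mult N \<gamma> \<sigma> \<in> star2_set N A}"

definition star2_left_quot :: "('a::semigroup_mult, 'v) nonstandard_structure \<Rightarrow> 'v \<Rightarrow> 'v set \<Rightarrow> 'v set" where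
  "star2_left_quot N x B = {\<sigma> \<in> star2_set N UNIV. star2_mult N x \<sigma> \<in> B}"

end

theory Submission
  imports Defs
begin

text \<open>
  For (1), the internal sets of hyperfinite \<open>\<Gamma> \<subseteq> V\<^sup>*\<close> with \<open>\<Gamma>\<^sup>-\<^sup>1A\<^sup>* \<in> \<F>\<^sup>*\<close>, for \<open>V \<in> \<F>\<close>, are nonempty
  and directed when \<open>A\<close> is \<open>\<F>\<close>-syndetic, so saturation gives one \<open>\<Gamma>\<close> in all of them; the converse
  is transfer. For (2), put \<open>T = {y \<in> S. y\<beta> \<in> A\<^sup>*}\<close>. Since \<open>\<beta> \<in> (x\<^sup>-\<^sup>1G\<^sup>-\<^sup>1A)\<^sup>*\<close> iff \<open>x \<in> G\<^sup>-\<^sup>1T\<close> for finite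
  \<open>G\<close>, the finite intersection property together with saturation says that \<open>A\<close> is piecewise
  \<open>\<F>\<close>-syndetic iff \<open>T\<close> is \<open>\<F>\<close>-syndetic for some \<open>\<beta> \<in> \<mu>(\<F>)\<close>. By (1) this means
  \<open>\<Gamma>\<^sup>-\<^sup>1T\<^sup>* \<in> \<F>\<^sup>*\<close> for some hyperfinite \<open>\<Gamma> \<subseteq> \<mu>(\<F>)\<close>, and by transfer \<open>x \<in> \<Gamma>\<^sup>-\<^sup>1T\<^sup>*\<close> iff
  \<open>x\<beta>\<^sup>* \<in> \<Gamma>\<^sup>-\<^sup>1A\<^sup>*\<^sup>*\<close>, so one can take \<open>W = \<Gamma>\<^sup>-\<^sup>1T\<^sup>*\<close>.
\<close>

section \<open>Elementary facts on filters and quotients\<close>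

lemma filter_sets_Int: "V \<in> filter_sets F \<Longrightarrow> W \<in> filter_sets F \<Longrightarrow> V \<inter> W \<in> filter_sets F"
  by (simp add: filter_sets_def eventually_conj_iff)

lemma filter_sets_mono: "V \<in> filter_sets F \<Longrightarrow> V \<subseteq> W \<Longrightarrow> W \<in> filter_sets F"
  by (auto simp: filter_sets_def elim: eventually_mono)

lemma UNIV_in_filter_sets: "UNIV \<in> filter_sets F"
  by (simp add: filter_sets_def)

lemma filter_sets_INT:
  "finite I \<Longrightarrow> (\<And>i. i \<in> I \<Longrightarrow> V i \<in> filter_sets F) \<Longrightarrow> (\<Inter>i\<in>I. V i) \<in> filter_sets F"
  by (induction I rule: finite_induct) (auto simp: UNIV_in_filter_sets filter_sets_Int)

text \<open>Associativity, \<open>g(xy) = (gx)y\<close>, absorbs the inner translation into the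
  index set.\<close>

lemma left_quot_left_quot_set: "left_quot x (left_quot_set G A) = left_quot_set ((\<lambda>g. g * x) ` G) A"
  by (auto simp: left_quot_def left_quot_set_def mult.assoc)

context nonstandard_extension
begin

subsection \<open>Objects of the universe\<close>

lemma mk_set:
  assumes "has_set N B"
  shows elts_mk_set: "elts N (mk_set N B) = B" and mk_set_not_atom: "mk_set N B \<notin> atoms N"
proof -
  obtain x where x: "x \<notin> atoms N \<and> elts N x = B"
    using assms unfolding has_set_def by blast
  have "mk_set N B \<notin> atoms N \<and> elts N (mk_set N B) = B"
    unfolding mk_set_def using x by (rule theI) (use x extensionality in blast)
  then show "elts N (mk_set N B) = B" "mk_set N B \<notin> atoms N"
    by auto
qed

text \<open>Atoms have no elements, so nonemptiness of \<open>B\<close> rules them out and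
  extensionality applies.\<close>

lemma eq_mk_set_iff:
  assumes "has_set N B" "B \<noteq> {}"
  shows "x = mk_set N B \<longleftrightarrow> elts N x = B"
  using assms mk_set[OF assms(1)] atoms_empty extensionality by metis

lemma has_set_subset: "has_set N B \<Longrightarrow> C \<subseteq> B \<Longrightarrow> has_set N C"
  using subsets unfolding has_set_def by blast

lemma has_set_singleton: "has_set N {a}"
  using pairing[of a a] by simp

text \<open>Kuratowski's pair is described with bounded quantifiers only, so that being a pair can
  be transferred; \<open>u\<close> and \<open>v\<close> stand for \<open>{a}\<close> and
  \<open>{a, b}\<close>.\<close>

lemma eq_mk_pair_iff:
  "p = mk_pair N a b \<longleftrightarrow>
    (\<exists>u\<in>elts N p. \<exists>v\<in>elts N p. (\<forall>w\<in>elts N p. w = u \<or> w = v) \<and>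
       (a \<in> elts N u \<and> (\<forall>w\<in>elts N u. w = a)) \<and>
       (a \<in> elts N v \<and> b \<in> elts N v \<and> (\<forall>w\<in>elts N v. w = a \<or> w = b)))"
proof -
  have "p = mk_pair N a b \<longleftrightarrow> elts N p = {mk_set N {a}, mk_set N {a, b}}"
    unfolding mk_pair_def by (intro eq_mk_set_iff pairing) simp
  also have "\<dots> \<longleftrightarrow> (\<exists>u v. elts N p = {u, v} \<and> elts N u = {a} \<and> elts N v = {a, b})"
    using eq_mk_set_iff[OF has_set_singleton, of a] eq_mk_set_iff[OF pairing, of a b]
    by (metis insert_not_empty)
  also have "\<dots> \<longleftrightarrow> (\<exists>u\<in>elts N p. \<exists>v\<in>elts N p. (\<forall>w\<in>elts N p. w = u \<or> w = v) \<and>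
       (a \<in> elts N u \<and> (\<forall>w\<in>elts N u. w = a)) \<and>
       (a \<in> elts N v \<and> b \<in> elts N v \<and> (\<forall>w\<in>elts N v. w = a \<or> w = b)))"
    (is "?L \<longleftrightarrow> ?R")
  proof
    assume ?L
    then show ?R by blast
  next
    assume ?R
    then obtain u v where "elts N p = {u, v}" "elts N u = {a}" "elts N v = {a, b}"
      by blast
    then show ?L by blast
  qed
  finally show ?thesis .
qed

lemma mk_pair_inject: "mk_pair N a b = mk_pair N c d \<longleftrightarrow> a = c \<and> b = d"
proof
  have *: "elts N (mk_pair N a b) = {mk_set N {a}, mk_set N {a, b}}" for a b
    unfolding mk_pair_def by (rule elts_mk_set[OF pairing])
  have e: "elts N (mk_set N {a}) = {a}" "elts N (mk_set N {a, b}) = {a, b}" for a b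
    by (rule elts_mk_set, rule pairing has_set_singleton)+
  assume "mk_pair N a b = mk_pair N c d"
  \<comment> \<open>Passing to sets of elements leaves ordinary Kuratowski pairs of HOL
    sets.\<close>
  then have "elts N ` {mk_set N {a}, mk_set N {a, b}} = elts N ` {mk_set N {c}, mk_set N {c, d}}"
    using * by metis
  then have "{{a}, {a, b}} = {{c}, {c, d}}"
    by (simp add: e)
  then show "a = c \<and> b = d"
    by (auto simp: doubleton_eq_iff)
qed simp

lemma elts_set_obj: "elts N (set_obj N A) = emb N ` A"
  unfolding set_obj_def by (rule elts_mk_set, rule has_set_subset[OF set_S]) auto

lemma set_obj_not_atom: "set_obj N A \<notin> atoms N"
  unfolding set_obj_def by (rule mk_set_not_atom, rule has_set_subset[OF set_S]) auto

lemma emb_eq_iff: "emb N x = emb N y \<longleftrightarrow> x = y"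
  using inj_emb by (simp add: inj_eq)

lemma emb_mem_set_obj_iff: "emb N x \<in> elts N (set_obj N A) \<longleftrightarrow> x \<in> A"
  by (auto simp: elts_set_obj emb_eq_iff)

lemma set_obj_eq_iff: "set_obj N A = set_obj N B \<longleftrightarrow> A = B"
  by (metis elts_set_obj inj_emb inj_image_eq_iff)

text \<open>Families of subsets of \<open>S\<close> are objects because the power set of
  \<open>S\<close> is one and objects are closed under subsets.\<close>

lemma elts_family_obj: "elts N (family_obj N \<C>) = set_obj N ` \<C>"
  unfolding family_obj_def
  by (rule elts_mk_set, rule has_set_subset[OF power_S]) (auto simp: set_obj_not_atom elts_set_obj)

lemma set_obj_mem_family_obj_iff: "set_obj N A \<in> elts N (family_obj N \<C>) \<longleftrightarrow> A \<in> \<C>"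
  by (auto simp: elts_family_obj set_obj_eq_iff)


subsection \<open>Transfer\<close>

text \<open>The index \<open>k\<close> has no meaning of its own: it is the next unused variable, which lets the
  quantifier rules below pick fresh variables by resolution alone.\<close>

definition bounded :: "nat \<Rightarrow> ((nat \<Rightarrow> 'v) \<Rightarrow> bool) \<Rightarrow> bool" where
  "bounded k P \<longleftrightarrow> (\<exists>\<phi>. \<forall>e. holds N e \<phi> \<longleftrightarrow> P e)"

lemma bounded_transfer: "bounded k P \<Longrightarrow> P (\<lambda>i. star N (e i)) \<longleftrightarrow> P e"
  unfolding bounded_def using transfer by metis

lemma bounded_mem: "bounded k (\<lambda>e. e i \<in> elts N (e j))"
  unfolding bounded_def by (rule exI[of _ "Mem i j"]) simp

lemma bounded_eq: "bounded k (\<lambda>e. e i = e j)"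
  unfolding bounded_def by (rule exI[of _ "Eq i j"]) simp

lemma bounded_not:
  assumes "bounded k P"
  shows "bounded k (\<lambda>e. \<not> P e)"
proof -
  obtain \<phi> where "\<And>e. holds N e \<phi> \<longleftrightarrow> P e"
    using assms unfolding bounded_def by blast
  then show ?thesis
    unfolding bounded_def by (intro exI[of _ "Neg \<phi>"]) simp
qed

lemma bounded_conj:
  assumes "bounded k P" "bounded k Q"
  shows "bounded k (\<lambda>e. P e \<and> Q e)"
proof -
  obtain \<phi> \<psi> where "\<And>e. holds N e \<phi> \<longleftrightarrow> P e" "\<And>e. holds N e \<psi> \<longleftrightarrow> Q e"
    using assms unfolding bounded_def by blast
  then show ?thesis
    unfolding bounded_def by (intro exI[of _ "Conj \<phi> \<psi>"]) simp
qed

lemma bounded_disj: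
  assumes "bounded k P" "bounded k Q"
  shows "bounded k (\<lambda>e. P e \<or> Q e)"
  using bounded_not[OF bounded_conj[OF bounded_not[OF assms(1)] bounded_not[OF assms(2)]]] by simp

lemma bounded_imp:
  assumes "bounded k P" "bounded k Q"
  shows "bounded k (\<lambda>e. P e \<longrightarrow> Q e)"
  using bounded_disj[OF bounded_not[OF assms(1)] assms(2)] by simp

lemma bounded_iff:
  assumes "bounded k P" "bounded k Q"
  shows "bounded k (\<lambda>e. P e \<longleftrightarrow> Q e)"
  unfolding iff_conv_conj_imp by (intro bounded_conj bounded_imp assms)

text \<open>Variable \<open>k\<close> becomes the bound one; the second premise says that
  \<open>P\<close> does not read its old value, so overwriting it is harmless.\<close>

lemma bounded_ball:
  assumes "bounded (Suc k) (\<lambda>e. P e (e k))"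
    and "\<And>e x y. P (e(k := x)) y = P e y"
  shows "bounded k (\<lambda>e. \<forall>x\<in>elts N (e j). P e x)"
proof -
  obtain \<phi> where "\<And>e. holds N e \<phi> \<longleftrightarrow> P e (e k)"
    using assms(1) unfolding bounded_def by blast
  then have "\<forall>e. holds N e (Ball k j \<phi>) \<longleftrightarrow> (\<forall>x\<in>elts N (e j). P e x)"
    by (simp add: assms(2))
  then show ?thesis
    unfolding bounded_def by blast
qed

lemma bounded_bex:
  assumes "bounded (Suc k) (\<lambda>e. P e (e k))"
    and "\<And>e x y. P (e(k := x)) y = P e y"
  shows "bounded k (\<lambda>e. \<exists>x\<in>elts N (e j). P e x)"
proof -
  have "bounded k (\<lambda>e. \<not> (\<forall>x\<in>elts N (e j). \<not> P e x))"
    by (intro bounded_not bounded_ball assms) (simp add: assms)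
  then show ?thesis by simp
qed

lemmas bounded_basic_intros = bounded_mem bounded_eq bounded_not bounded_conj bounded_disj
  bounded_imp bounded_iff bounded_ball bounded_bex

lemma bounded_mk_pair:
  assumes "i < k" "j < k" "l < k"
  shows "bounded k (\<lambda>e. e i = mk_pair N (e j) (e l))"
proof -
  \<comment> \<open>The description of a pair nests three quantifiers, which take the variables
    \<open>k\<close>, \<open>Suc k\<close> and \<open>Suc (Suc k)\<close>; the free variables must
    differ from these.\<close>
  have [simp]: "i \<noteq> k" "j \<noteq> k" "l \<noteq> k" "i \<noteq> Suc k" "j \<noteq> Suc k" "l \<noteq> Suc k"
    "i \<noteq> Suc (Suc k)" "j \<noteq> Suc (Suc k)" "l \<noteq> Suc (Suc k)"
    using assms by auto
  show ?thesis
    unfolding eq_mk_pair_iff by (intro bounded_basic_intros; simp)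
qed

text \<open>A relation is used because the description operator in \<open>apply_op\<close> is not a
  bounded formula; the parameter \<open>m\<close> lets it serve \<open>S\<close>, \<open>S*\<close>
  and \<open>S**\<close> alike.\<close>

definition mult_graph :: "'v \<Rightarrow> 'v \<Rightarrow> 'v \<Rightarrow> 'v \<Rightarrow> bool" where
  "mult_graph m a b c \<longleftrightarrow> mk_pair N a (mk_pair N b c) \<in> elts N m"

lemma bounded_mult_graph:
  assumes "h < k" "i < k" "j < k" "l < k"
  shows "bounded k (\<lambda>e. mult_graph (e h) (e i) (e j) (e l))"
proof -
  have [simp]: "h \<noteq> k" "i \<noteq> k" "j \<noteq> k" "l \<noteq> k" "h \<noteq> Suc k" "i \<noteq> Suc k" "j \<noteq> Suc k" "l \<noteq> Suc k"
    "h \<noteq> Suc (Suc k)" "i \<noteq> Suc (Suc k)" "j \<noteq> Suc (Suc k)" "l \<noteq> Suc (Suc k)"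
    using assms by auto
  \<comment> \<open>The inner pair \<open>q\<close> is an element of an element of \<open>p\<close>,
    which yields bounds for all quantifiers.\<close>
  have "mult_graph m a b c \<longleftrightarrow>
      (\<exists>p\<in>elts N m. \<exists>u\<in>elts N p. \<exists>q\<in>elts N u. p = mk_pair N a q \<and> q = mk_pair N b c)" for m a b c
    unfolding mult_graph_def using eq_mk_pair_iff[of "mk_pair N a (mk_pair N b c)" a "mk_pair N b c"]
    by blast
  then show ?thesis
    by (simp only:) (intro bounded_basic_intros bounded_mk_pair; simp add: assms less_SucI)
qed

lemmas bounded_intros = bounded_basic_intros bounded_mult_graph bounded_mk_pair

section \<open>First consequences of transfer and saturation\<close>

lemma star_mem_iff: "star N x \<in> elts N (star N y) \<longleftrightarrow> x \<in> elts N y"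
  \<comment> \<open>The list is the environment: variable \<open>i\<close> is its entry
    \<open>i\<close>, and no variable beyond its length is read.\<close>
  using bounded_transfer[OF bounded_mem[of 2 0 1], of "(!) [x, y]"] by simp

lemma emb_mem_star_set_iff: "emb N x \<in> star_set N A \<longleftrightarrow> x \<in> A"
  unfolding star_set_def by (metis star_mem_iff star_emb emb_mem_set_obj_iff)

lemma star_subset_iff: "elts N (star N x) \<subseteq> elts N (star N y) \<longleftrightarrow> elts N x \<subseteq> elts N y"
proof -
  have "bounded 2 (\<lambda>e. \<forall>x\<in>elts N (e 0). x \<in> elts N (e 1))"
    by (intro bounded_intros; simp)
  from bounded_transfer[OF this, of "(!) [x, y]"] show ?thesis
    by (simp add: subset_eq)
qed

text \<open>This is the enlarging property. Each \<open>star N (X i)\<close> is internal, being an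
  element of the star of a singleton, and \<open>star\<close> sends a common element of finitely
  many \<open>X i\<close> to one of their extensions.\<close>

lemma star_saturation:
  fixes X :: "'a set \<Rightarrow> 'v"
  assumes "\<And>I. finite I \<Longrightarrow> (\<Inter>i\<in>I. elts N (X i)) \<noteq> {}"
  obtains x where "\<And>i. x \<in> elts N (star N (X i))"
proof -
  have "(\<Inter>i. elts N (star N (X i))) \<noteq> {}"
  proof (rule saturation)
    fix i
    have "X i \<in> elts N (mk_set N {X i})"
      by (simp add: elts_mk_set has_set_singleton)
    then show "\<exists>y. star N (X i) \<in> elts N (star N y)"
      using star_mem_iff by blast
  next
    show "fin_inter_prop (range (\<lambda>i. elts N (star N (X i))))"
      unfolding fin_inter_prop_def
    proof (intro allI impI)
      fix \<D> assume "\<D> \<subseteq> range (\<lambda>i. elts N (star N (X i)))" "finite \<D>"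
      then obtain I where I: "finite I" "\<D> = (\<lambda>i. elts N (star N (X i))) ` I"
        using finite_subset_image by metis
      obtain x where "x \<in> (\<Inter>i\<in>I. elts N (X i))"
        using assms[OF I(1)] by blast
      then have "star N x \<in> \<Inter>\<D>"
        by (auto simp: I(2) star_mem_iff)
      then show "\<Inter>\<D> \<noteq> {}" by blast
    qed
  qed
  then show thesis
    using that by blast
qed


subsection \<open>The extended multiplications\<close>

text \<open>The set \<open>u\<close> of the first clause serves only to bound the quantifier over \<open>q\<close>.\<close>

definition is_assoc_op :: "'v \<Rightarrow> 'v \<Rightarrow> bool" where
  "is_assoc_op U m \<longleftrightarrow>
    (\<forall>p\<in>elts N m. \<exists>x\<in>elts N U. \<exists>y\<in>elts N U. \<exists>z\<in>elts N U. \<exists>u\<in>elts N p. \<exists>q\<in>elts N u.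
       p = mk_pair N x q \<and> q = mk_pair N y z) \<and>
    (\<forall>x\<in>elts N U. \<forall>y\<in>elts N U. \<exists>z\<in>elts N U. mult_graph m x y z \<and>
       (\<forall>w\<in>elts N U. mult_graph m x y w \<longrightarrow> w = z)) \<and>
    (\<forall>x\<in>elts N U. \<forall>y\<in>elts N U. \<forall>z\<in>elts N U. \<forall>u\<in>elts N U. \<forall>v\<in>elts N U. \<forall>w\<in>elts N U.
       mult_graph m x y u \<longrightarrow> mult_graph m y z v \<longrightarrow> mult_graph m u z w \<longrightarrow> mult_graph m x v w)"

text \<open>Being a statement about arbitrary objects, it covers both the step from \<open>S\<close>
  to \<open>S*\<close> and the step from \<open>S*\<close> to \<open>S**\<close>.\<close>

lemma is_assoc_op_star: "is_assoc_op (star N U) (star N m) \<longleftrightarrow> is_assoc_op U m"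
proof -
  have "bounded 2 (\<lambda>e. is_assoc_op (e 0) (e 1))"
    unfolding is_assoc_op_def by (intro bounded_intros; simp)
  from bounded_transfer[OF this, of "(!) [U, m]"] show ?thesis
    by simp
qed

lemma mult_graph_iff_apply_op:
  assumes "is_assoc_op U m" "x \<in> elts N U" "y \<in> elts N U"
  shows "mult_graph m x y z \<longleftrightarrow> z = apply_op N m x y"
proof -
  \<comment> \<open>Uniqueness of products is stated only within \<open>U\<close>; the first clause
    of \<open>is_assoc_op\<close> and injectivity of pairs put every value there.\<close>
  have U: "c \<in> elts N U" if "mult_graph m x y c" for c
    using assms(1) that unfolding is_assoc_op_def mult_graph_def
    by (metis mk_pair_inject)
  obtain z' where "mult_graph m x y z'" "\<And>w. mult_graph m x y w \<Longrightarrow> w = z'"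
    using assms U unfolding is_assoc_op_def by metis
  then have "apply_op N m x y = z'" and "mult_graph m x y z \<longleftrightarrow> z = z'"
    unfolding apply_op_def mult_graph_def by blast+
  then show ?thesis by auto
qed

lemma apply_op_closed:
  assumes "is_assoc_op U m" "x \<in> elts N U" "y \<in> elts N U"
  shows "apply_op N m x y \<in> elts N U"
  using assms mult_graph_iff_apply_op[OF assms] unfolding is_assoc_op_def by metis

lemma apply_op_assoc:
  assumes "is_assoc_op U m" "x \<in> elts N U" "y \<in> elts N U" "z \<in> elts N U"
  shows "apply_op N m (apply_op N m x y) z = apply_op N m x (apply_op N m y z)"
proof -
  note closed = apply_op_closed[OF assms(1)] and graph = mult_graph_iff_apply_op[OF assms(1)]
  define u v w where uvw: "u = apply_op N m x y" "v = apply_op N m y z" "w = apply_op N m u z"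
  have mem: "u \<in> elts N U" "v \<in> elts N U" "w \<in> elts N U"
    unfolding uvw by (intro closed assms)+
  have "mult_graph m x y u" "mult_graph m y z v" "mult_graph m u z w"
    using graph assms mem uvw by blast+
  then have "mult_graph m x v w"
    using assms mem unfolding is_assoc_op_def by blast
  then show ?thesis
    using graph assms mem uvw by blast
qed

end

locale nonstandard_semigroup_extension = nonstandard_extension N
  for N :: "('a::semigroup_mult, 'v) nonstandard_structure"
begin

text \<open>The graph exists as an object because it is a subset of
  \<open>S \<times> (S \<times> S)\<close>.\<close>

lemma elts_mult_obj:
  "elts N (mult_obj N) = {mk_pair N (emb N x) (mk_pair N (emb N y) (emb N (x * y))) | x y. True}"
proof -
  define S2 where "S2 = mk_set N {mk_pair N a b | a b. a \<in> range (emb N) \<and> b \<in> range (emb N)}"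
  have S2: "elts N S2 = {mk_pair N a b | a b. a \<in> range (emb N) \<and> b \<in> range (emb N)}"
    using elts_mk_set[OF products[of "set_obj N UNIV" "set_obj N UNIV"]]
    by (simp add: S2_def elts_set_obj)
  have "has_set N {mk_pair N a b | a b. a \<in> elts N (set_obj N UNIV) \<and> b \<in> elts N S2}"
    by (rule products)
  then have "has_set N {mk_pair N (emb N x) (mk_pair N (emb N y) (emb N (x * y))) | x y. True}"
    by (rule has_set_subset) (unfold elts_set_obj S2, blast)
  then show ?thesis
    unfolding mult_obj_def by (rule elts_mk_set)
qed

lemma mult_graph_emb_iff: "mult_graph (mult_obj N) (emb N x) (emb N y) c \<longleftrightarrow> c = emb N (x * y)"
  by (auto simp: mult_graph_def elts_mult_obj mk_pair_inject emb_eq_iff)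

lemma is_assoc_op_mult_obj: "is_assoc_op (set_obj N UNIV) (mult_obj N)"
proof -
  \<comment> \<open>These are the witnesses \<open>u\<close> and \<open>q\<close> required by the
    first clause of \<open>is_assoc_op\<close>.\<close>
  have "\<exists>u\<in>elts N (mk_pair N a b). \<exists>q\<in>elts N u. mk_pair N a b = mk_pair N a q \<and> q = b" for a b
    using eq_mk_pair_iff[of "mk_pair N a b" a b] by blast
  then show ?thesis
    unfolding is_assoc_op_def
    by (simp add: elts_set_obj mult_graph_emb_iff emb_eq_iff mult.assoc)
      (fastforce simp: elts_mult_obj)
qed

lemma star_mult_assoc_op:
  "is_assoc_op (star N (set_obj N UNIV)) (star N (mult_obj N))"
  by (simp add: is_assoc_op_star is_assoc_op_mult_obj)

lemma star2_mult_assoc_op: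
  "is_assoc_op (star N (star N (set_obj N UNIV))) (star N (star N (mult_obj N)))"
  by (simp add: is_assoc_op_star is_assoc_op_mult_obj)

lemmas star_mult_graph_iff = mult_graph_iff_apply_op[OF star_mult_assoc_op, folded star_mult_def star_set_def]
lemmas star_mult_closed = apply_op_closed[OF star_mult_assoc_op, folded star_mult_def star_set_def]
lemmas star_mult_assoc = apply_op_assoc[OF star_mult_assoc_op, folded star_mult_def star_set_def]
lemmas star2_mult_graph_iff = mult_graph_iff_apply_op[OF star2_mult_assoc_op, folded star2_mult_def star2_set_def]
lemmas star2_mult_closed = apply_op_closed[OF star2_mult_assoc_op, folded star2_mult_def star2_set_def]

lemma emb_mem_star_set_UNIV: "emb N x \<in> star_set N UNIV"
  by (simp add: emb_mem_star_set_iff)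

lemma star_mult_emb: "star_mult N (emb N x) (emb N y) = emb N (x * y)"
proof -
  have "bounded 4 (\<lambda>e. mult_graph (e 0) (e 1) (e 2) (e 3))"
    by (intro bounded_intros; simp)
  from bounded_transfer[OF this, of "(!) [mult_obj N, emb N x, emb N y, emb N (x * y)]"]
  have "mult_graph (star N (mult_obj N)) (emb N x) (emb N y) (emb N (x * y))"
    by (simp add: star_emb mult_graph_emb_iff)
  then show ?thesis
    by (simp add: star_mult_graph_iff emb_mem_star_set_UNIV)
qed

lemma star_set_mono: "A \<subseteq> B \<Longrightarrow> star_set N A \<subseteq> star_set N B"
  unfolding star_set_def star_subset_iff elts_set_obj by auto

text \<open>The inclusion of \<open>S\<close> in \<open>S*\<close> holds because \<open>star\<close>
  fixes embedded points; applying \<open>star\<close> to it gives the claim.\<close>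

lemma star_set_subset_star2_set: "star_set N UNIV \<subseteq> star2_set N UNIV"
proof -
  have "elts N (set_obj N UNIV) \<subseteq> elts N (star N (set_obj N UNIV))"
    using emb_mem_star_set_UNIV by (auto simp: elts_set_obj star_set_def)
  then show ?thesis
    unfolding star_set_def star2_set_def star_subset_iff .
qed

text \<open>This places hyperfinite sets and members of the starred filter inside \<open>S*\<close>,
  where the product is defined.\<close>

lemma star_family_obj_subset:
  assumes "G \<in> elts N (star N (family_obj N \<C>))"
  shows "elts N G \<subseteq> star_set N UNIV"
proof -
  have "bounded 2 (\<lambda>e. \<forall>G\<in>elts N (e 0). \<forall>x\<in>elts N G. x \<in> elts N (e 1))"
    by (intro bounded_intros; simp)
  from bounded_transfer[OF this, of "(!) [family_obj N \<C>, set_obj N UNIV]"]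
  have "\<forall>G\<in>elts N (star N (family_obj N \<C>)). \<forall>x\<in>elts N G. x \<in> star_set N UNIV"
    by (simp add: star_set_def elts_family_obj elts_set_obj)
  then show ?thesis
    using assms by blast
qed


subsection \<open>Syndetic sets\<close>

text \<open>The equation \<open>Q = G^-1 A\<close> as a bounded formula. Only points of
  \<open>U\<close> are tested, so it determines \<open>Q\<close> among subsets of
  \<open>U\<close>.\<close>

definition is_quot :: "'v \<Rightarrow> 'v \<Rightarrow> 'v \<Rightarrow> 'v \<Rightarrow> 'v \<Rightarrow> bool" where
  "is_quot U m A G Q \<longleftrightarrow>
    (\<forall>y\<in>elts N U. y \<in> elts N Q \<longleftrightarrow> (\<exists>g\<in>elts N G. \<exists>w\<in>elts N A. mult_graph m g y w))"

lemma bounded_is_quot: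
  assumes "u < k" "h < k" "a < k" "i < k" "j < k"
  shows "bounded k (\<lambda>e. is_quot (e u) (e h) (e a) (e i) (e j))"
proof -
  have [simp]: "u \<noteq> k" "h \<noteq> k" "a \<noteq> k" "i \<noteq> k" "j \<noteq> k"
    "u \<noteq> Suc k" "h \<noteq> Suc k" "a \<noteq> Suc k" "i \<noteq> Suc k" "j \<noteq> Suc k"
    "u \<noteq> Suc (Suc k)" "h \<noteq> Suc (Suc k)" "a \<noteq> Suc (Suc k)" "i \<noteq> Suc (Suc k)" "j \<noteq> Suc (Suc k)"
    using assms by auto
  show ?thesis
    unfolding is_quot_def by (intro bounded_intros; simp add: assms less_SucI)
qed

lemma is_quot_set_obj_iff:
  "is_quot (set_obj N UNIV) (mult_obj N) (set_obj N A) (set_obj N G) (set_obj N Q) \<longleftrightarrow>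
    Q = left_quot_set G A"
  by (auto simp: is_quot_def elts_set_obj mult_graph_emb_iff emb_eq_iff left_quot_set_def
      left_quot_def)

text \<open>The inclusion for \<open>G\<close> lets the graph be read as \<open>star_mult\<close>;
  the one for \<open>Q\<close> makes the test on \<open>S*\<close> decide equality.\<close>

lemma is_quot_star_iff:
  assumes "elts N G \<subseteq> star_set N UNIV" "elts N Q \<subseteq> star_set N UNIV"
  shows "is_quot (star N (set_obj N UNIV)) (star N (mult_obj N)) (star N (set_obj N A)) G Q \<longleftrightarrow>
    elts N Q = star_quot N (elts N G) A"
proof -
  have "(\<exists>w\<in>star_set N A. mult_graph (star N (mult_obj N)) g y w) \<longleftrightarrow> star_mult N g y \<in> star_set N A"
    if "g \<in> elts N G" "y \<in> star_set N UNIV" for g y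
  proof -
    have "g \<in> star_set N UNIV"
      using that assms(1) by blast
    then show ?thesis
      using that by (auto simp: star_mult_graph_iff)
  qed
  then show ?thesis
    using assms(2) unfolding is_quot_def star_quot_def star_set_def by blast
qed

text \<open>Asking for an object \<open>Q\<close> of the starred filter, rather than for the HOL set
  \<open>star_quot\<close>, gives the condition the form that transfer delivers.\<close>

abbreviation syndetic_witness :: "'a filter \<Rightarrow> 'a set \<Rightarrow> 'v \<Rightarrow> bool" where
  "syndetic_witness F A G \<equiv> \<exists>Q\<in>elts N (star N (family_obj N (filter_sets F))).
     is_quot (star N (set_obj N UNIV)) (star N (mult_obj N)) (star N (set_obj N A)) G Q"

lemma syndetic_witness_iff:
  assumes "elts N G \<subseteq> star_set N UNIV"
  shows "syndetic_witness F A G \<longleftrightarrow> star_quot N (elts N G) A \<in> star_family N (filter_sets F)"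
  unfolding star_family_def
  using is_quot_star_iff[OF assms star_family_obj_subset] by auto

lemma hyperfinite_witness_if_syndetic:
  assumes "syndetic F A"
  shows "\<exists>\<Gamma>. hyperfinite N \<Gamma> \<and> \<Gamma> \<subseteq> monad N F \<and> star_quot N \<Gamma> A \<in> star_family N (filter_sets F)"
proof -
  \<comment> \<open>Saturation is indexed by all subsets of \<open>S\<close>, so sets outside the
    filter are replaced by the harmless member \<open>UNIV\<close>.\<close>
  define clip where "clip V = (if V \<in> filter_sets F then V else UNIV)" for V
  define X where
    "X V = family_obj N {G. finite G \<and> G \<subseteq> clip V \<and> left_quot_set G A \<in> filter_sets F}" for V
  have clip: "clip V \<in> filter_sets F" for V
    by (simp add: clip_def UNIV_in_filter_sets)
  have "(\<Inter>i\<in>I. elts N (X i)) \<noteq> {}" if "finite I" for I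
  proof -
    \<comment> \<open>Syndeticity for the intersection of finitely many members gives one
      \<open>G\<close> that works for each of them.\<close>
    have "(\<Inter>i\<in>I. clip i) \<in> filter_sets F"
      using that clip by (rule filter_sets_INT)
    then obtain G where "finite G" "G \<subseteq> (\<Inter>i\<in>I. clip i)" "left_quot_set G A \<in> filter_sets F"
      using assms unfolding syndetic_def by blast
    then have "set_obj N G \<in> (\<Inter>i\<in>I. elts N (X i))"
      by (auto simp: X_def set_obj_mem_family_obj_iff)
    then show ?thesis by blast
  qed
  then obtain \<gamma> where \<gamma>: "\<gamma> \<in> elts N (star N (X V))" for V
    using star_saturation by metis
  \<comment> \<open>The properties shared by all elements of \<open>X V\<close> are transferred, so
    that \<open>\<gamma>\<close> inherits them for every \<open>V\<close>.\<close>
  have "bounded 7 (\<lambda>e. \<forall>G\<in>elts N (e 0). G \<in> elts N (e 1) \<and> (\<forall>g\<in>elts N G. g \<in> elts N (e 2)) \<and>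
      (\<exists>Q\<in>elts N (e 3). is_quot (e 4) (e 5) (e 6) G Q))"
    by (intro bounded_intros bounded_is_quot; simp)
  note tr = bounded_transfer[OF this]
  have *: "\<gamma> \<in> elts N (star N (family_obj N {G. finite G})) \<and>
      (\<forall>g\<in>elts N \<gamma>. g \<in> star_set N (clip V)) \<and> syndetic_witness F A \<gamma>" for V
  proof -
    have "\<forall>G\<in>elts N (X V). G \<in> elts N (family_obj N {G. finite G}) \<and>
        (\<forall>g\<in>elts N G. g \<in> elts N (set_obj N (clip V))) \<and>
        (\<exists>Q\<in>elts N (family_obj N (filter_sets F)).
          is_quot (set_obj N UNIV) (mult_obj N) (set_obj N A) G Q)"
    proof
      fix G assume "G \<in> elts N (X V)"
      then obtain G' where G': "G = set_obj N G'" "finite G'" "G' \<subseteq> clip V"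
          "left_quot_set G' A \<in> filter_sets F"
        by (auto simp: X_def elts_family_obj)
      then show "G \<in> elts N (family_obj N {G. finite G}) \<and>
        (\<forall>g\<in>elts N G. g \<in> elts N (set_obj N (clip V))) \<and>
        (\<exists>Q\<in>elts N (family_obj N (filter_sets F)).
          is_quot (set_obj N UNIV) (mult_obj N) (set_obj N A) G Q)"
        by (auto simp: set_obj_mem_family_obj_iff elts_set_obj is_quot_set_obj_iff elts_family_obj)
    qed
    then show ?thesis
      using \<gamma>[of V] tr[of "(!) [X V, family_obj N {G. finite G}, set_obj N (clip V),
        family_obj N (filter_sets F), set_obj N UNIV, mult_obj N, set_obj N A]"]
      by (simp add: star_set_def)
  qed
  have sub: "elts N \<gamma> \<subseteq> star_set N UNIV"
    using star_family_obj_subset \<gamma> X_def by metis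
  have "elts N \<gamma> \<subseteq> star_set N V" if "V \<in> filter_sets F" for V
    using *[of V] that by (auto simp: clip_def)
  then have "elts N \<gamma> \<subseteq> monad N F"
    using sub unfolding monad_def by blast
  moreover have "hyperfinite N (elts N \<gamma>)"
    using * unfolding hyperfinite_def star_family_def by blast
  moreover have "star_quot N (elts N \<gamma>) A \<in> star_family N (filter_sets F)"
    using * syndetic_witness_iff[OF sub] by blast
  ultimately show ?thesis by blast
qed

text \<open>Since the monad lies in the extension of each \<open>V\<close>, the same
  \<open>\<Gamma>\<close> shows for every \<open>V\<close> that a suitable hyperfinite set exists;
  transfer downwards turns it into a finite \<open>G\<close>.\<close>

lemma syndetic_if_hyperfinite_witness:
  assumes "hyperfinite N \<Gamma>" "\<Gamma> \<subseteq> monad N F" "star_quot N \<Gamma> A \<in> star_family N (filter_sets F)"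
  shows "syndetic F A"
  unfolding syndetic_def
proof
  fix V assume V: "V \<in> filter_sets F"
  obtain \<gamma> where \<gamma>: "\<gamma> \<in> elts N (star N (family_obj N {G. finite G}))" "\<Gamma> = elts N \<gamma>"
    using assms(1) unfolding hyperfinite_def star_family_def by blast
  have "syndetic_witness F A \<gamma>"
    using assms(3) syndetic_witness_iff star_family_obj_subset[OF \<gamma>(1)] \<gamma>(2) by blast
  moreover have "\<forall>g\<in>elts N \<gamma>. g \<in> star_set N V"
    using assms(2) V \<gamma>(2) unfolding monad_def by blast
  moreover have "bounded 6 (\<lambda>e. \<exists>G\<in>elts N (e 0). (\<forall>g\<in>elts N G. g \<in> elts N (e 1)) \<and>
      (\<exists>Q\<in>elts N (e 2). is_quot (e 3) (e 4) (e 5) G Q))"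
    by (intro bounded_intros bounded_is_quot; simp)
  note tr = bounded_transfer[OF this]
  ultimately have "\<exists>G\<in>elts N (family_obj N {G. finite G}).
      (\<forall>g\<in>elts N G. g \<in> elts N (set_obj N V)) \<and> (\<exists>Q\<in>elts N (family_obj N (filter_sets F)).
        is_quot (set_obj N UNIV) (mult_obj N) (set_obj N A) G Q)"
    using \<gamma>(1) tr[of "(!) [family_obj N {G. finite G}, set_obj N V,
        family_obj N (filter_sets F), set_obj N UNIV, mult_obj N, set_obj N A]"]
    by (simp add: star_set_def) blast
  then obtain G Q where "finite G" "\<forall>g\<in>elts N (set_obj N G). g \<in> elts N (set_obj N V)"
      "Q \<in> filter_sets F" "Q = left_quot_set G A"
    by (auto simp: elts_family_obj is_quot_set_obj_iff)
  then have "G \<subseteq> V" "finite G" "left_quot_set G A \<in> filter_sets F"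
    by (auto simp: elts_set_obj emb_eq_iff)
  then show "\<exists>G\<subseteq>V. finite G \<and> left_quot_set G A \<in> filter_sets F"
    by blast
qed


lemma syndetic_iff_hyperfinite:
  "syndetic F A \<longleftrightarrow>
    (\<exists>\<Gamma>. hyperfinite N \<Gamma> \<and> \<Gamma> \<subseteq> monad N F \<and> star_quot N \<Gamma> A \<in> star_family N (filter_sets F))"
  using hyperfinite_witness_if_syndetic syndetic_if_hyperfinite_witness by blast


subsection \<open>Piecewise syndetic sets\<close>

text \<open>The set \<open>T\<close> of the overview. For \<open>\<beta>\<close> in
  \<open>S*\<close> and the ultrafilter of all \<open>B\<close> whose extension contains
  \<open>\<beta>\<close>, it consists of the \<open>y\<close> with \<open>y^-1 A\<close> in that
  ultrafilter. It is a subset of \<open>S\<close>, so \<open>star\<close> and the first equivalence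
  apply to it.\<close>

definition right_trace :: "'v \<Rightarrow> 'a set \<Rightarrow> 'a set" where
  "right_trace \<beta> A = {y. star_mult N (emb N y) \<beta> \<in> star_set N A}"

text \<open>Transfer of the definition of \<open>y^-1 A\<close>, the parameter \<open>y\<close>
  being fixed by \<open>star\<close>.\<close>

lemma mem_right_trace_iff:
  assumes "\<beta> \<in> star_set N UNIV"
  shows "y \<in> right_trace \<beta> A \<longleftrightarrow> \<beta> \<in> star_set N (left_quot y A)"
proof -
  have "bounded 5 (\<lambda>e. \<forall>z\<in>elts N (e 0). z \<in> elts N (e 1) \<longleftrightarrow>
      (\<exists>w\<in>elts N (e 2). mult_graph (e 3) (e 4) z w))"
    by (intro bounded_intros; simp)
  from bounded_transfer[OF this, of "(!) [set_obj N UNIV, set_obj N (left_quot y A), set_obj N A,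
    mult_obj N, emb N y]"]
  have "\<forall>z\<in>star_set N UNIV. z \<in> star_set N (left_quot y A) \<longleftrightarrow>
      (\<exists>w\<in>star_set N A. mult_graph (star N (mult_obj N)) (emb N y) z w)"
    by (auto simp: elts_set_obj star_set_def star_emb mult_graph_emb_iff emb_eq_iff left_quot_def)
  then show ?thesis
    using assms by (auto simp: right_trace_def star_mult_graph_iff emb_mem_star_set_UNIV)
qed

text \<open>Transfer gives the empty set and binary unions, and induction the finite ones; infinite
  unions need not be preserved.\<close>

lemma star_set_left_quot_set_finite:
  assumes "finite G"
  shows "star_set N (left_quot_set G A) = (\<Union>g\<in>G. star_set N (left_quot g A))"
proof -
  have Un: "star_set N (B \<union> C) = star_set N B \<union> star_set N C" for B C
  proof -
    have "bounded 3 (\<lambda>e. \<forall>z\<in>elts N (e 0). z \<in> elts N (e 1) \<or> z \<in> elts N (e 2))"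
      by (intro bounded_intros; simp)
    from bounded_transfer[OF this, of "(!) [set_obj N (B \<union> C), set_obj N B, set_obj N C]"]
    have "star_set N (B \<union> C) \<subseteq> star_set N B \<union> star_set N C"
      by (auto simp: star_set_def elts_set_obj)
    then show ?thesis
      using star_set_mono[of B "B \<union> C"] star_set_mono[of C "B \<union> C"] by blast
  qed
  have empty: "star_set N {} = {}"
  proof -
    have "bounded 1 (\<lambda>e. \<forall>z\<in>elts N (e 0). z \<noteq> z)"
      by (intro bounded_intros; simp)
    from bounded_transfer[OF this, of "(!) [set_obj N {}]"] show ?thesis
      by (auto simp: star_set_def elts_set_obj)
  qed
  show ?thesis
    using assms by induction (auto simp: left_quot_set_def empty Un)
qed

lemma star_set_Int: "star_set N (B \<inter> C) = star_set N B \<inter> star_set N C"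
proof -
  have "bounded 3 (\<lambda>e. \<forall>z\<in>elts N (e 0). z \<in> elts N (e 1) \<longrightarrow> z \<in> elts N (e 2))"
    by (intro bounded_intros; simp)
  from bounded_transfer[OF this, of "(!) [set_obj N B, set_obj N C, set_obj N (B \<inter> C)]"]
  have "star_set N B \<inter> star_set N C \<subseteq> star_set N (B \<inter> C)"
    by (auto simp: star_set_def elts_set_obj emb_eq_iff)
  then show ?thesis
    using star_set_mono[of "B \<inter> C" B] star_set_mono[of "B \<inter> C" C] by blast
qed

lemma star_set_nonempty_iff: "star_set N B \<noteq> {} \<longleftrightarrow> B \<noteq> {}"
proof -
  have "bounded 1 (\<lambda>e. \<exists>z\<in>elts N (e 0). z = z)"
    by (intro bounded_intros; simp)
  from bounded_transfer[OF this, of "(!) [set_obj N B]"] show ?thesis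
    by (auto simp: star_set_def elts_set_obj)
qed

text \<open>Saturation produces \<open>\<beta>\<close>; conversely \<open>\<beta>\<close> lies in
  the extension of every finite intersection, which is then nonempty by transfer.\<close>

lemma fin_inter_prop_iff_star:
  "fin_inter_prop \<C> \<longleftrightarrow> (\<exists>\<beta>\<in>star_set N UNIV. \<forall>B\<in>\<C>. \<beta> \<in> star_set N B)"
proof
  assume fip: "fin_inter_prop \<C>"
  \<comment> \<open>Again \<open>UNIV\<close> is the default outside the family, since the index set
    is fixed.\<close>
  define clip where "clip B = (if B \<in> \<C> then B else UNIV)" for B
  have "(\<Inter>B\<in>I. elts N (set_obj N (clip B))) \<noteq> {}" if "finite I" for I
  proof -
    have "\<Inter>(I \<inter> \<C>) \<noteq> {}"
      using fip that unfolding fin_inter_prop_def by (metis finite_Int inf_le2)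
    then obtain x where "x \<in> \<Inter>(I \<inter> \<C>)"
      by blast
    then have "x \<in> clip B" if "B \<in> I" for B
      using that by (simp add: clip_def)
    then have "emb N x \<in> (\<Inter>B\<in>I. elts N (set_obj N (clip B)))"
      by (auto simp: elts_set_obj)
    then show ?thesis by blast
  qed
  then obtain \<beta> where \<beta>: "\<beta> \<in> star_set N (clip B)" for B
    using star_saturation[of "\<lambda>B. set_obj N (clip B)"] unfolding star_set_def by metis
  have "\<beta> \<in> star_set N UNIV"
    using \<beta> star_set_mono by blast
  moreover have "\<beta> \<in> star_set N B" if "B \<in> \<C>" for B
    using \<beta>[of B] that by (simp add: clip_def)
  ultimately show "\<exists>\<beta>\<in>star_set N UNIV. \<forall>B\<in>\<C>. \<beta> \<in> star_set N B"
    by blast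
next
  assume "\<exists>\<beta>\<in>star_set N UNIV. \<forall>B\<in>\<C>. \<beta> \<in> star_set N B"
  then obtain \<beta> where \<beta>: "\<beta> \<in> star_set N UNIV" "\<And>B. B \<in> \<C> \<Longrightarrow> \<beta> \<in> star_set N B"
    by blast
  show "fin_inter_prop \<C>"
    unfolding fin_inter_prop_def
  proof (intro allI impI)
    fix \<D> assume "\<D> \<subseteq> \<C>" "finite \<D>"
    \<comment> \<open>The empty intersection is \<open>UNIV\<close>, which is the case
      \<open>\<beta> \<in> S*\<close>.\<close>
    from this(2,1) have "\<beta> \<in> star_set N (\<Inter>\<D>)"
      by induction (auto simp: \<beta> star_set_Int)
    then show "\<Inter>\<D> \<noteq> {}"
      using star_set_nonempty_iff by blast
  qed
qed

text \<open>Both sides say that \<open>gx\<close> lies in the trace for some \<open>g\<close> in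
  \<open>G\<close>, because \<open>x^-1 G^-1 A\<close> is the finite union of the sets
  \<open>(gx)^-1 A\<close>.\<close>

lemma mem_star_set_left_quot_iff:
  assumes "\<beta> \<in> star_set N UNIV" "finite G"
  shows "\<beta> \<in> star_set N (left_quot x (left_quot_set G A)) \<longleftrightarrow>
    x \<in> left_quot_set G (right_trace \<beta> A)"
  using assms
  by (auto simp: left_quot_left_quot_set star_set_left_quot_set_finite mem_right_trace_iff[symmetric])
    (auto simp: left_quot_set_def left_quot_def)

lemma piecewise_syndetic_iff_trace:
  assumes "F \<noteq> bot"
  shows "piecewise_syndetic F A \<longleftrightarrow> (\<exists>\<beta>\<in>monad N F. syndetic F (right_trace \<beta> A))"
proof
  assume "piecewise_syndetic F A"
  then obtain K W where
    KW: "\<And>V. V \<in> filter_sets F \<Longrightarrow> finite (K V) \<and> K V \<subseteq> V \<and> W V \<in> filter_sets F" and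
    fip: "fin_inter_prop {left_quot x (left_quot_set (K V) A) \<inter> V | V x. V \<in> filter_sets F \<and> x \<in> W V}"
    unfolding piecewise_syndetic_def by blast
  obtain \<beta> where \<beta>: "\<beta> \<in> star_set N UNIV" and
    mem_all: "\<forall>B\<in>{left_quot x (left_quot_set (K V) A) \<inter> V | V x. V \<in> filter_sets F \<and> x \<in> W V}.
      \<beta> \<in> star_set N B"
    using fip unfolding fin_inter_prop_iff_star by (elim bexE)
  have mem: "\<beta> \<in> star_set N (left_quot x (left_quot_set (K V) A) \<inter> V)"
    if "V \<in> filter_sets F" "x \<in> W V" for V x
    by (rule bspec[OF mem_all]) (use that in blast)
  have "\<beta> \<in> star_set N V" if "V \<in> filter_sets F" for V
  proof -
    \<comment> \<open>Properness of \<open>F\<close> enters here: some member of the family is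
      contained in \<open>V\<close>, which forces \<open>\<beta>\<close> into the extension of
      \<open>V\<close>.\<close>
    have "W V \<noteq> {}"
      using KW[OF that] assms by (auto simp: filter_sets_def)
    then show ?thesis
      using mem[OF that] by (auto simp: star_set_Int)
  qed
  then have "\<beta> \<in> monad N F"
    using \<beta> by (simp add: monad_def)
  moreover have "syndetic F (right_trace \<beta> A)"
    unfolding syndetic_def
  proof
    fix V assume V: "V \<in> filter_sets F"
    have "W V \<subseteq> left_quot_set (K V) (right_trace \<beta> A)"
      using mem[OF V] KW[OF V] by (auto simp: star_set_Int mem_star_set_left_quot_iff[OF \<beta>])
    then have "left_quot_set (K V) (right_trace \<beta> A) \<in> filter_sets F"
      using KW[OF V] filter_sets_mono by blast
    then show "\<exists>G\<subseteq>V. finite G \<and> left_quot_set G (right_trace \<beta> A) \<in> filter_sets F"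
      using KW[OF V] by blast
  qed
  ultimately show "\<exists>\<beta>\<in>monad N F. syndetic F (right_trace \<beta> A)"
    by blast
next
  assume "\<exists>\<beta>\<in>monad N F. syndetic F (right_trace \<beta> A)"
  then obtain \<beta> K where \<beta>: "\<beta> \<in> monad N F" and
    K: "\<And>V. V \<in> filter_sets F \<Longrightarrow>
      finite (K V) \<and> K V \<subseteq> V \<and> left_quot_set (K V) (right_trace \<beta> A) \<in> filter_sets F"
    unfolding syndetic_def by metis
  \<comment> \<open>This is the set of all \<open>x\<close> for which \<open>\<beta>\<close> lies in
    the extension of \<open>x^-1 (K V)^-1 A\<close>.\<close>
  define W where "W V = left_quot_set (K V) (right_trace \<beta> A)" for V
  have \<beta>': "\<beta> \<in> star_set N UNIV" "\<And>V. V \<in> filter_sets F \<Longrightarrow> \<beta> \<in> star_set N V"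
    using \<beta> by (auto simp: monad_def)
  have "\<beta> \<in> star_set N (left_quot x (left_quot_set (K V) A) \<inter> V)"
    if "V \<in> filter_sets F" "x \<in> W V" for V x
    using that K[OF that(1)] \<beta>'
    by (simp add: star_set_Int mem_star_set_left_quot_iff W_def)
  then have "\<forall>B\<in>{left_quot x (left_quot_set (K V) A) \<inter> V | V x. V \<in> filter_sets F \<and> x \<in> W V}.
      \<beta> \<in> star_set N B"
    by (intro ballI) (elim CollectE exE conjE, simp)
  then have "fin_inter_prop {left_quot x (left_quot_set (K V) A) \<inter> V | V x. V \<in> filter_sets F \<and> x \<in> W V}"
    unfolding fin_inter_prop_iff_star using \<beta>'(1) by (intro bexI)
  then show "piecewise_syndetic F A"
    unfolding piecewise_syndetic_def using K by (intro exI[of _ K] exI[of _ W]) (simp add: W_def)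
qed

section \<open>Passage to the second extension\<close>

lemma star_mem_star2_set:
  assumes "\<beta> \<in> star_set N UNIV"
  shows "star N \<beta> \<in> star2_set N UNIV"
  using assms by (simp add: star_set_def star2_set_def star_mem_iff)

text \<open>For \<open>a\<close>, \<open>b\<close> in \<open>S\<close>, \<open>ab\<close> is in the
  trace iff \<open>a(b\<beta>)\<close> is in \<open>A*\<close>. Here \<open>\<beta>\<close>,
  \<open>A*\<close> and the product of \<open>S*\<close> are parameters, so transfer turns them into
  \<open>\<beta>*\<close>, \<open>A**\<close> and the product of \<open>S**\<close>.\<close>

lemma star_mult_mem_star_right_trace_iff:
  assumes "\<beta> \<in> star_set N UNIV" "g \<in> star_set N UNIV" "x \<in> star_set N UNIV"
  shows "star_mult N g x \<in> star_set N (right_trace \<beta> A) \<longleftrightarrow>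
    star2_mult N g (star2_mult N x (star N \<beta>)) \<in> star2_set N A"
proof -
  \<comment> \<open>Here \<open>z\<close> stands for \<open>gx\<close>, \<open>u\<close> for
    \<open>x\<beta>\<close> and \<open>w\<close> for \<open>gu\<close>; variables 3 to 5 are
    assigned objects that are already starred.\<close>
  have "bounded 7 (\<lambda>e. \<forall>g\<in>elts N (e 0). \<forall>x\<in>elts N (e 0). \<forall>z\<in>elts N (e 0). mult_graph (e 1) g x z \<longrightarrow>
     (z \<in> elts N (e 2) \<longleftrightarrow> (\<exists>u\<in>elts N (e 3). \<exists>w\<in>elts N (e 4).
       mult_graph (e 5) x (e 6) u \<and> mult_graph (e 5) g u w)))"
    by (intro bounded_intros; simp)
  note tr = bounded_transfer[OF this, of "(!) [set_obj N UNIV, mult_obj N, set_obj N (right_trace \<beta> A),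
     star N (set_obj N UNIV), star N (set_obj N A), star N (mult_obj N), \<beta>]"]
  have "(\<exists>u\<in>star_set N UNIV. \<exists>w\<in>star_set N A. mult_graph (star N (mult_obj N)) (emb N b) \<beta> u \<and>
         mult_graph (star N (mult_obj N)) (emb N a) u w) \<longleftrightarrow> a * b \<in> right_trace \<beta> A" for a b
  proof -
    have "star_mult N (emb N (a * b)) \<beta> = star_mult N (emb N a) (star_mult N (emb N b) \<beta>)"
      using star_mult_assoc[OF emb_mem_star_set_UNIV emb_mem_star_set_UNIV assms(1)]
      by (simp add: star_mult_emb)
    then show ?thesis
      using star_mult_graph_iff[OF emb_mem_star_set_UNIV] star_mult_closed[OF emb_mem_star_set_UNIV] assms(1)
      unfolding right_trace_def by (metis mem_Collect_eq)
  qed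
  then have "\<forall>g\<in>star_set N UNIV. \<forall>x\<in>star_set N UNIV. \<forall>z\<in>star_set N UNIV.
      mult_graph (star N (mult_obj N)) g x z \<longrightarrow>
     (z \<in> star_set N (right_trace \<beta> A) \<longleftrightarrow> (\<exists>u\<in>star2_set N UNIV. \<exists>w\<in>star2_set N A.
       mult_graph (star N (star N (mult_obj N))) x (star N \<beta>) u \<and>
       mult_graph (star N (star N (mult_obj N))) g u w))"
    using tr by (simp add: star_set_def star2_set_def elts_set_obj mult_graph_emb_iff image_iff emb_eq_iff)
  moreover have "mult_graph (star N (mult_obj N)) g x (star_mult N g x)"
    using star_mult_graph_iff assms by blast
  ultimately have "star_mult N g x \<in> star_set N (right_trace \<beta> A) \<longleftrightarrow>
     (\<exists>u\<in>star2_set N UNIV. \<exists>w\<in>star2_set N A.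
       mult_graph (star N (star N (mult_obj N))) x (star N \<beta>) u \<and>
       mult_graph (star N (star N (mult_obj N))) g u w)"
    using star_mult_closed assms by blast
  also have "\<dots> \<longleftrightarrow> star2_mult N g (star2_mult N x (star N \<beta>)) \<in> star2_set N A"
  proof -
    \<comment> \<open>Points of \<open>S*\<close> can be multiplied in \<open>S**\<close> by the
      inclusion between the two.\<close>
    have mem: "g \<in> star2_set N UNIV" "x \<in> star2_set N UNIV" "star N \<beta> \<in> star2_set N UNIV"
      using assms star_set_subset_star2_set star_mem_star2_set by blast+
    then show ?thesis
      using star2_mult_graph_iff star2_mult_closed by metis
  qed
  finally show ?thesis .
qed

lemma star2_mult_mem_star2_quot_iff:
  assumes "\<beta> \<in> star_set N UNIV" "\<Gamma> \<subseteq> star_set N UNIV" "x \<in> star_set N UNIV"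
  shows "star2_mult N x (star N \<beta>) \<in> star2_quot N \<Gamma> A \<longleftrightarrow> x \<in> star_quot N \<Gamma> (right_trace \<beta> A)"
proof -
  have "star2_mult N x (star N \<beta>) \<in> star2_set N UNIV"
    using assms star_set_subset_star2_set star_mem_star2_set star2_mult_closed by blast
  then show ?thesis
    using assms star_mult_mem_star_right_trace_iff[OF assms(1) _ assms(3)]
    unfolding star2_quot_def star_quot_def by blast
qed

text \<open>Upward closure of the filter is transferred for quotients by finite sets. The formula
  itself provides an object \<open>Q\<close> for the quotient, so no separate proof that the
  quotient is internal is required.\<close>

lemma star_quot_mem_star_filter:
  assumes "W \<in> star_family N (filter_sets F)" "hyperfinite N \<Gamma>" "W \<subseteq> star_quot N \<Gamma> A"
  shows "star_quot N \<Gamma> A \<in> star_family N (filter_sets F)"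
proof -
  let ?P = "\<lambda>U m A P \<F>. \<forall>G\<in>elts N P. \<forall>W\<in>elts N \<F>.
    (\<forall>x\<in>elts N W. \<exists>g\<in>elts N G. \<exists>w\<in>elts N A. mult_graph m g x w) \<longrightarrow>
    (\<exists>Q\<in>elts N \<F>. is_quot U m A G Q)"
  obtain \<gamma> where \<gamma>: "\<gamma> \<in> elts N (star N (family_obj N {G. finite G}))" "\<Gamma> = elts N \<gamma>"
    using assms(2) unfolding hyperfinite_def star_family_def by blast
  obtain w where w: "w \<in> elts N (star N (family_obj N (filter_sets F)))" "W = elts N w"
    using assms(1) unfolding star_family_def by blast
  note sub = star_family_obj_subset[OF \<gamma>(1)]
  have "bounded 5 (\<lambda>e. ?P (e 0) (e 1) (e 2) (e 3) (e 4))"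
    by (intro bounded_intros bounded_is_quot; simp)
  note tr = bounded_transfer[OF this, of "(!) [set_obj N UNIV, mult_obj N, set_obj N A,
    family_obj N {G. finite G}, family_obj N (filter_sets F)]"]
  have "?P (set_obj N UNIV) (mult_obj N) (set_obj N A) (family_obj N {G. finite G})
    (family_obj N (filter_sets F))"
  proof (intro ballI impI)
    fix G W
    assume "G \<in> elts N (family_obj N {G. finite G})" "W \<in> elts N (family_obj N (filter_sets F))"
      and le: "\<forall>x\<in>elts N W. \<exists>g\<in>elts N G. \<exists>w\<in>elts N (set_obj N A). mult_graph (mult_obj N) g x w"
    then obtain G' W' where G': "G = set_obj N G'" and W': "W = set_obj N W'" "W' \<in> filter_sets F"
      by (auto simp: elts_family_obj)
    have "W' \<subseteq> left_quot_set G' A"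
      using le by (auto simp: G' W' elts_set_obj mult_graph_emb_iff emb_eq_iff left_quot_set_def
          left_quot_def)
    then have "left_quot_set G' A \<in> filter_sets F"
      using W'(2) filter_sets_mono by blast
    then show "\<exists>Q\<in>elts N (family_obj N (filter_sets F)).
        is_quot (set_obj N UNIV) (mult_obj N) (set_obj N A) G Q"
      by (auto simp: elts_family_obj G' is_quot_set_obj_iff)
  qed
  then have P: "?P (star N (set_obj N UNIV)) (star N (mult_obj N)) (star N (set_obj N A))
      (star N (family_obj N {G. finite G})) (star N (family_obj N (filter_sets F)))"
    using tr by simp
  have "\<exists>g\<in>elts N \<gamma>. \<exists>w\<in>elts N (star N (set_obj N A)). mult_graph (star N (mult_obj N)) g x w"
    if x: "x \<in> elts N w" for x
  proof -
    obtain g where g: "g \<in> elts N \<gamma>" "star_mult N g x \<in> star_set N A" "x \<in> star_set N UNIV"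
      using x assms(3) unfolding w(2) \<gamma>(2) star_quot_def by blast
    then have "mult_graph (star N (mult_obj N)) g x (star_mult N g x)"
      using star_mult_graph_iff sub by blast
    then show ?thesis
      using g unfolding star_set_def by blast
  qed
  then have "syndetic_witness F A \<gamma>"
    using P \<gamma>(1) w(1) by blast
  then show ?thesis
    using syndetic_witness_iff[OF sub] \<gamma>(2) by blast
qed

text \<open>The first equivalence is applied to the trace: its quotient serves as \<open>W\<close>,
  and conversely any \<open>W\<close> below that quotient puts it into the starred filter.\<close>

lemma syndetic_trace_iff:
  assumes "\<beta> \<in> monad N F"
  shows "syndetic F (right_trace \<beta> A) \<longleftrightarrow>
    (\<exists>W \<Gamma>. W \<in> star_family N (filter_sets F) \<and> hyperfinite N \<Gamma> \<and> \<Gamma> \<subseteq> monad N F \<and>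
      (\<lambda>x. star2_mult N x (star N \<beta>)) ` W \<subseteq> star2_quot N \<Gamma> A)"
proof -
  have \<beta>: "\<beta> \<in> star_set N UNIV"
    using assms by (simp add: monad_def)
  have *: "(\<lambda>x. star2_mult N x (star N \<beta>)) ` W \<subseteq> star2_quot N \<Gamma> A \<longleftrightarrow>
      W \<subseteq> star_quot N \<Gamma> (right_trace \<beta> A)"
    if "\<Gamma> \<subseteq> monad N F" "W \<in> star_family N (filter_sets F)" for W \<Gamma>
  proof -
    have "\<Gamma> \<subseteq> star_set N UNIV" "W \<subseteq> star_set N UNIV"
      using that star_family_obj_subset unfolding monad_def star_family_def by blast+
    then show ?thesis
      using star2_mult_mem_star2_quot_iff[OF \<beta>] by blast
  qed
  show ?thesis
  proof
    assume "syndetic F (right_trace \<beta> A)"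
    then obtain \<Gamma> where \<Gamma>: "hyperfinite N \<Gamma>" "\<Gamma> \<subseteq> monad N F"
        "star_quot N \<Gamma> (right_trace \<beta> A) \<in> star_family N (filter_sets F)"
      unfolding syndetic_iff_hyperfinite by blast
    then show "\<exists>W \<Gamma>. W \<in> star_family N (filter_sets F) \<and> hyperfinite N \<Gamma> \<and> \<Gamma> \<subseteq> monad N F \<and>
        (\<lambda>x. star2_mult N x (star N \<beta>)) ` W \<subseteq> star2_quot N \<Gamma> A"
      using *[OF \<Gamma>(2,3)] by (intro exI[of _ "star_quot N \<Gamma> (right_trace \<beta> A)"] exI[of _ \<Gamma>]) simp
  next
    assume "\<exists>W \<Gamma>. W \<in> star_family N (filter_sets F) \<and> hyperfinite N \<Gamma> \<and> \<Gamma> \<subseteq> monad N F \<and>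
        (\<lambda>x. star2_mult N x (star N \<beta>)) ` W \<subseteq> star2_quot N \<Gamma> A"
    then obtain W \<Gamma> where W: "W \<in> star_family N (filter_sets F)" and \<Gamma>: "hyperfinite N \<Gamma>"
        "\<Gamma> \<subseteq> monad N F" and sub: "(\<lambda>x. star2_mult N x (star N \<beta>)) ` W \<subseteq> star2_quot N \<Gamma> A"
      by (elim exE conjE)
    have "W \<subseteq> star_quot N \<Gamma> (right_trace \<beta> A)"
      using *[OF \<Gamma>(2) W] sub by (rule iffD1)
    then show "syndetic F (right_trace \<beta> A)"
      unfolding syndetic_iff_hyperfinite using star_quot_mem_star_filter[OF W \<Gamma>(1)] \<Gamma> by blast
  qed
qed

lemma piecewise_syndetic_iff_hyperfinite:
  assumes "F \<noteq> bot"
  shows "piecewise_syndetic F A \<longleftrightarrow>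
    (\<exists>W \<Gamma> \<beta>. W \<in> star_family N (filter_sets F) \<and> hyperfinite N \<Gamma> \<and> \<Gamma> \<subseteq> monad N F \<and>
      \<beta> \<in> monad N F \<and> (\<lambda>x. star2_mult N x (star N \<beta>)) ` W \<subseteq> star2_quot N \<Gamma> A)"
  unfolding piecewise_syndetic_iff_trace[OF assms] using syndetic_trace_iff by blast

text \<open>The conjunct on the monad puts \<open>\<beta>*\<close> into \<open>S**\<close>, as
  membership in \<open>star2_left_quot\<close> demands.\<close>

lemma star_mem_INT_star2_left_quot_iff:
  "\<beta> \<in> monad N F \<and> star N \<beta> \<in> (\<Inter>x\<in>W. star2_left_quot N x B) \<longleftrightarrow>
    \<beta> \<in> monad N F \<and> (\<lambda>x. star2_mult N x (star N \<beta>)) ` W \<subseteq> B"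
  using star_mem_star2_set[of \<beta>] by (auto simp: star2_left_quot_def monad_def)

end

text \<open>The filter type contains the improper filter \<open>bot\<close>, so properness is stated
  as a hypothesis.\<close>

theorem proposition3p1:
  fixes N :: "('a::semigroup_mult, 'v) nonstandard_structure"
    and F :: "'a filter"
    and A :: "'a set"
  assumes "nonstandard_extension N"
    and "F \<noteq> bot"
  shows "(syndetic F A \<longleftrightarrow>
           (\<exists>\<Gamma>. hyperfinite N \<Gamma> \<and> \<Gamma> \<subseteq> monad N F \<and>
              star_quot N \<Gamma> A \<in> star_family N (filter_sets F))) \<and>
         (piecewise_syndetic F A \<longleftrightarrow>
           (\<exists>W \<Gamma> \<beta>. W \<in> star_family N (filter_sets F) \<and>
              hyperfinite N \<Gamma> \<and> \<Gamma> \<subseteq> monad N F \<and> \<beta> \<in> monad N F \<and>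
              star N \<beta> \<in> (\<Inter>x\<in>W. star2_left_quot N x (star2_quot N \<Gamma> A)))) \<and>
         (piecewise_syndetic F A \<longleftrightarrow>
           (\<exists>W \<Gamma> \<beta>. W \<in> star_family N (filter_sets F) \<and>
              hyperfinite N \<Gamma> \<and> \<Gamma> \<subseteq> monad N F \<and> \<beta> \<in> monad N F \<and>
              (\<lambda>x. star2_mult N x (star N \<beta>)) ` W \<subseteq> star2_quot N \<Gamma> A))"
proof -
  interpret nonstandard_extension N by fact
  interpret nonstandard_semigroup_extension N ..
  show ?thesis
    unfolding star_mem_INT_star2_left_quot_iff
    by (intro conjI syndetic_iff_hyperfinite piecewise_syndetic_iff_hyperfinite assms(2))
qed

end
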